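(* Let $x\in\mathcal D$, let $\mathrm{Proj}_x$ be a linear projector of $\mathcal E$ onto $\mathrm T_x\mathcal M_x=\ker\mathrm Dc(x)$ with kernel $\mathrm N_x\mathcal M_x$, let $G_T(x),G_N(x):\mathcal E\to\mathcal E$ be Euclidean-symmetric operators that are positive definite on $\mathrm T_x\mathcal M_x$ and on $\mathrm N_x\mathcal M_x$ respectively, and let $g$ be the metric $$g(\xi,\zeta)=\langle\mathrm{Proj}_x\xi,G_T(x)\mathrm{Proj}_x\zeta\rangle_{\mathcal E}+\langle\mathrm{Proj}_x^\perp\xi,G_N(x)\mathrm{Proj}_x^\perp\zeta\rangle_{\mathcal E}.$$ Then the landing directions $d_T(x)=-\mathrm{grad}^g_{\mathcal M_x}f(x)$ and $d_N(x)=-\nabla_g\psi(x)$ are given by $$d_T(x)=-\widetilde{G_T}(x)^{-1}\mathrm{Proj}_x^{*,\mathcal E}\nabla_{\mathcal E}f(x),\qquad d_N(x)=-\widetilde{G_N}(x)^{-1}\mathrm Dc(x)^{*,\mathcal E}c(x).$$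
   Context: $\mathcal E,\mathcal F$ are finite-dimensional Euclidean spaces, $m=\dim\mathcal F<\dim\mathcal E$; $f:\mathcal E\to\mathbb R$ and $c:\mathcal E\to\mathcal F$ are continuously differentiable; $\mathcal D=\{x\in\mathcal E:\operatorname{rank}\mathrm Dc(x)=m\}$; $\mathcal M_x=\{y:c(y)=c(x)\}$; $\psi(x)=\frac12\|c(x)\|_{\mathcal F}^2$. A superscript $^{*,\mathcal E}$ denotes the Euclidean adjoint and $V^{\perp,\mathcal E}$ the Euclidean orthogonal complement of a subspace $V\subset\mathcal E$. $\nabla_{\mathcal E}f$ is the Euclidean gradient; $\nabla_g\psi(x)$ is the unique vector of $\mathcal E$ with $g(\nabla_g\psi(x),\xi)=\mathrm D\psi(x)[\xi]$ for all $\xi\in\mathcal E$; $\mathrm{grad}^g_{\mathcal M_x}f(x)$ is the unique vector in $\mathrm T_x\mathcal M_x$ with $g(\mathrm{grad}^g_{\mathcal M_x}f(x),\xi)=\mathrm Df(x)[\xi]$ for all $\xi\in\mathrm T_x\mathcal M_x$. $\mathrm{Proj}_x^\perp=\mathrm{Id}_{\mathcal E}-\mathrm{Proj}_x$ (the projectors are possibly oblique). The operators $$\widetilde{G_T}(x)=\mathrm{Proj}_x^{*,\mathcal E}G_T(x)\mathrm{Proj}_x:\mathrm T_x\mathcal M_x\to(\mathrm N_x\mathcal M_x)^{\perp,\mathcal E},\quad \widetilde{G_N}(x)=(\mathrm{Proj}_x^\perp)^{*,\mathcal E}G_N(x)\mathrm{Proj}_x^\perp:\mathrm N_x\mathcal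 M_x\to(\mathrm T_x\mathcal M_x)^{\perp,\mathcal E}$$ are invertible between the indicated spaces, and $\widetilde{G_T}(x)^{-1},\widetilde{G_N}(x)^{-1}$ denote these inverses. Note that $\mathrm{Range}(\mathrm{Proj}_x^{*,\mathcal E})=(\mathrm N_x\mathcal M_x)^{\perp,\mathcal E}$ and $\mathrm{Range}(\mathrm Dc(x)^{*,\mathcal E})=(\mathrm T_x\mathcal M_x)^{\perp,\mathcal E}$. *)

theory Defs
  imports "HOL-Analysis.Analysis"
begin

section \<open>Differentials, gradients and the constraint set\<close>

definition continuously_differentiable ::
    "('a::real_normed_vector \<Rightarrow> 'b::real_normed_vector) \<Rightarrow> bool" where
  "continuously_differentiable h \<longleftrightarrow>
     (\<exists>h' :: 'a \<Rightarrow> 'a \<Rightarrow>\<^sub>L 'b.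
        (\<forall>x. (h has_derivative blinfun_apply (h' x)) (at x)) \<and> continuous_on UNIV h')"

definition differential ::
    "('a::real_normed_vector \<Rightarrow> 'b::real_normed_vector) \<Rightarrow> 'a \<Rightarrow> 'a \<Rightarrow> 'b" where
  "differential h x = frechet_derivative h (at x)"

definition euclidean_gradient :: "('e::euclidean_space \<Rightarrow> real) \<Rightarrow> 'e \<Rightarrow> 'e" where
  "euclidean_gradient f x = (THE v. GDERIV f x :> v)"

definition full_rank_set :: "('e::euclidean_space \<Rightarrow> 'f::euclidean_space) \<Rightarrow> 'e set" where
  "full_rank_set c = {x. dim (range (differential c x)) = DIM('f)}"

definition op_kernel :: "('a::real_vector \<Rightarrow> 'b::real_vector) \<Rightarrow> 'a set" where
  "op_kernel A = {v. A v = 0}"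

text \<open>Used only at points of full rank, where it is the tangent space at \<open>x\<close> of the
  level set \<open>{y. c y = c x}\<close>.\<close>
definition tangent_space :: "('e::euclidean_space \<Rightarrow> 'f::euclidean_space) \<Rightarrow> 'e \<Rightarrow> 'e set" where
  "tangent_space c x = op_kernel (differential c x)"

definition infeasibility :: "('e::euclidean_space \<Rightarrow> 'f::euclidean_space) \<Rightarrow> 'e \<Rightarrow> real" where
  "infeasibility c x = (1/2) * (norm (c x))\<^sup>2"

section \<open>Oblique projectors and the metric\<close>

definition projector_onto_along ::
    "('e::real_vector \<Rightarrow> 'e) \<Rightarrow> 'e set \<Rightarrow> 'e set \<Rightarrow> bool" where
  "projector_onto_along P T N \<longleftrightarrow>
     linear P \<and> (\<forall>v. P (P v) = P v) \<and> range P = T \<and> op_kernel P = N"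

definition proj_perp :: "('e::real_vector \<Rightarrow> 'e) \<Rightarrow> 'e \<Rightarrow> 'e" where
  "proj_perp P v = v - P v"

definition symmetric_operator :: "('e::real_inner \<Rightarrow> 'e) \<Rightarrow> bool" where
  "symmetric_operator G \<longleftrightarrow> linear G \<and> (\<forall>u v. G u \<bullet> v = u \<bullet> G v)"

definition positive_definite_on :: "'e::real_inner set \<Rightarrow> ('e \<Rightarrow> 'e) \<Rightarrow> bool" where
  "positive_definite_on V G \<longleftrightarrow> (\<forall>v\<in>V. v \<noteq> 0 \<longrightarrow> v \<bullet> G v > 0)"

definition landing_metric ::
    "('e::euclidean_space \<Rightarrow> 'e) \<Rightarrow> ('e \<Rightarrow> 'e) \<Rightarrow> ('e \<Rightarrow> 'e) \<Rightarrow> 'e \<Rightarrow> 'e \<Rightarrow> real" where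
  "landing_metric P G\<^sub>T G\<^sub>N \<xi> \<zeta> =
     P \<xi> \<bullet> G\<^sub>T (P \<zeta>) + proj_perp P \<xi> \<bullet> G\<^sub>N (proj_perp P \<zeta>)"

definition gradient_on ::
    "('e::euclidean_space \<Rightarrow> 'e \<Rightarrow> real) \<Rightarrow> 'e set \<Rightarrow> ('e \<Rightarrow> real) \<Rightarrow> 'e \<Rightarrow> 'e" where
  "gradient_on g V h x = (THE v. v \<in> V \<and> (\<forall>\<xi>\<in>V. g v \<xi> = differential h x \<xi>))"

section \<open>Landing directions\<close>

definition tangent_direction ::
    "('e::euclidean_space \<Rightarrow> 'e \<Rightarrow> real) \<Rightarrow> ('e \<Rightarrow> 'f::euclidean_space) \<Rightarrow> ('e \<Rightarrow> real) \<Rightarrow> 'e \<Rightarrow> 'e"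
  where "tangent_direction g c f x = - gradient_on g (tangent_space c x) f x"

definition normal_direction ::
    "('e::euclidean_space \<Rightarrow> 'e \<Rightarrow> real) \<Rightarrow> ('e \<Rightarrow> 'f::euclidean_space) \<Rightarrow> 'e \<Rightarrow> 'e"
  where "normal_direction g c x = - gradient_on g UNIV (infeasibility c) x"

text \<open>The two reduced metric operators are \<open>compressed_op P G\<^sub>T\<close>, a bijection from the range
  \<open>T\<close> of \<open>P\<close> onto \<open>N\<^sup>\<bottom>\<close>, and \<open>compressed_op (proj_perp P) G\<^sub>N\<close>, a bijection from the kernel
  \<open>N\<close> of \<open>P\<close> onto \<open>T\<^sup>\<bottom>\<close>. Neither is invertible on the whole space in general; their inverses
  are \<open>inv_into T\<close> and \<open>inv_into N\<close>, see \<open>bij_betw_compressed_tangent\<close> and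
  \<open>bij_betw_compressed_normal\<close> below.\<close>
definition compressed_op :: "('e::euclidean_space \<Rightarrow> 'e) \<Rightarrow> ('e \<Rightarrow> 'e) \<Rightarrow> 'e \<Rightarrow> 'e" where
  "compressed_op Q G = adjoint Q \<circ> G \<circ> Q"

section \<open>Well-definedness\<close>

lemma linear_differential:
  assumes "continuously_differentiable h"
  shows "linear (differential h x)"
proof -
  have "h differentiable (at x)"
    using assms unfolding continuously_differentiable_def differentiable_def by blast
  then show ?thesis
    unfolding differential_def by (rule linear_frechet_derivative)
qed

lemma subspace_op_kernel: "linear A \<Longrightarrow> subspace (op_kernel A)"
  unfolding op_kernel_def by (simp add: subspace_def linear_0 linear_add linear_scale)

lemma linear_proj_perp: "linear P \<Longrightarrow> linear (proj_perp P)"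
  unfolding proj_perp_def[abs_def] by (intro linear_compose_sub linear_ident)

lemma projector_onto_along_perp:
  assumes "projector_onto_along P T N"
  shows "projector_onto_along (proj_perp P) N T"
proof -
  have P: "linear P" "\<And>v. P (P v) = P v" "T = range P" "N = op_kernel P"
    using assms by (auto simp: projector_onto_along_def)
  have "range (proj_perp P) = N"
  proof
    show "range (proj_perp P) \<subseteq> N"
      using P by (auto simp: proj_perp_def op_kernel_def linear_diff)
    show "N \<subseteq> range (proj_perp P)"
    proof
      fix v assume "v \<in> N"
      then have "v = proj_perp P v" using P by (simp add: proj_perp_def op_kernel_def)
      then show "v \<in> range (proj_perp P)" by blast
    qed
  qed
  moreover have "op_kernel (proj_perp P) = T"
    using P(2,3) by (force simp: op_kernel_def proj_perp_def)
  moreover have "proj_perp P (proj_perp P v) = proj_perp P v" for v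
    using P by (simp add: proj_perp_def linear_diff)
  ultimately show ?thesis
    using linear_proj_perp[OF P(1)] by (simp add: projector_onto_along_def)
qed

lemma adjoint_projector_in_orthogonal_comp:
  fixes P :: "'e::euclidean_space \<Rightarrow> 'e"
  assumes "projector_onto_along P T N"
  shows "adjoint P v \<in> N\<^sup>\<bottom>"
  using assms
  by (auto simp: projector_onto_along_def orthogonal_comp_def orthogonal_def
      adjoint_works op_kernel_def)

lemma adjoint_differential_in_orthogonal_comp:
  assumes "continuously_differentiable c"
  shows "adjoint (differential c x) y \<in> (tangent_space c x)\<^sup>\<bottom>"
  using adjoint_works[OF linear_differential[OF assms]]
  by (auto simp: tangent_space_def orthogonal_comp_def orthogonal_def op_kernel_def)

lemma bij_betw_compressed_tangent:
  fixes P :: "'e::euclidean_space \<Rightarrow> 'e"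
  assumes P: "projector_onto_along P T N"
    and G: "symmetric_operator G" "positive_definite_on T G"
  shows "bij_betw (compressed_op P G) T (N\<^sup>\<bottom>)"
proof -
  have lP: "linear P" and PP: "\<And>v. P (P v) = P v" and T: "T = range P" and N: "N = op_kernel P"
    using P by (auto simp: projector_onto_along_def)
  have lin: "linear (compressed_op P G)"
    unfolding compressed_op_def
    using G(1) by (intro linear_compose lP adjoint_linear) (simp add: symmetric_operator_def)
  have sT: "subspace T" unfolding T using linear_subspace_image[OF lP subspace_UNIV] .
  have inj: "inj_on (compressed_op P G) T"
  proof (rule linear_injective_on_subspace_0[OF lin sT, THEN iffD2], intro ballI impI)
    fix v assume v: "v \<in> T" "compressed_op P G v = 0"
    have Pv: "P v = v" using v(1) T PP by auto
    have "v \<bullet> G v = v \<bullet> compressed_op P G v"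
      by (simp add: compressed_op_def adjoint_works[OF lP] Pv)
    then have "v \<bullet> G v = 0" using v by simp
    then show "v = 0" using G(2) v(1) unfolding positive_definite_on_def by force
  qed
  have sub: "compressed_op P G ` T \<subseteq> N\<^sup>\<bottom>"
    using adjoint_projector_in_orthogonal_comp[OF P] by (auto simp: compressed_op_def)
  have sN: "subspace N" unfolding N by (rule subspace_op_kernel[OF lP])
  have "dim (N\<^sup>\<bottom>) + dim N = DIM('e)"
    using dim_subspace_orthogonal_to_vectors[OF sN subspace_UNIV]
    by (simp add: orthogonal_comp_def)
  moreover have "dim T + dim N = DIM('e)"
  proof -
    have "v = P v + (v - P v) \<and> P v \<in> T \<and> v - P v \<in> N" for v
      using PP by (simp add: T N op_kernel_def linear_diff[OF lP])
    then have "{u + w |u w. u \<in> T \<and> w \<in> N} = UNIV" by blast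
    moreover have "T \<inter> N = {0}"
      using PP linear_0[OF lP] by (force simp: T N op_kernel_def)
    ultimately show ?thesis using dim_sums_Int[OF sT sN] by simp
  qed
  ultimately have "dim (N\<^sup>\<bottom>) = dim T" by simp
  moreover have "dim (compressed_op P G ` T) = dim T"
    using inj dim_image_eq[OF lin, of T] span_eq_iff[THEN iffD2, OF sT] by simp
  ultimately have "compressed_op P G ` T = N\<^sup>\<bottom>"
    by (intro subspace_dim_equal[OF linear_subspace_image[OF lin sT] subspace_orthogonal_comp sub])
       simp
  with inj show ?thesis by (simp add: bij_betw_def)
qed

lemma bij_betw_compressed_normal:
  fixes P :: "'e::euclidean_space \<Rightarrow> 'e"
  assumes "projector_onto_along P T N" "symmetric_operator G" "positive_definite_on N G"
  shows "bij_betw (compressed_op (proj_perp P) G) N (T\<^sup>\<bottom>)"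
  by (rule bij_betw_compressed_tangent[OF projector_onto_along_perp[OF assms(1)] assms(2,3)])

lemma bilinear_landing_metric:
  assumes "linear P" "linear G\<^sub>T" "linear G\<^sub>N"
  shows "bilinear (landing_metric P G\<^sub>T G\<^sub>N)"
  using assms linear_proj_perp[OF assms(1)]
  unfolding bilinear_def landing_metric_def
  by (auto intro!: linearI simp: linear_add linear_scale inner_add_left inner_add_right
      algebra_simps)

lemma landing_metric_pos:
  assumes P: "projector_onto_along P T N"
    and "positive_definite_on T G\<^sub>T" "positive_definite_on N G\<^sub>N"
    and lin: "linear G\<^sub>T" "linear G\<^sub>N" and "\<xi> \<noteq> 0"
  shows "landing_metric P G\<^sub>T G\<^sub>N \<xi> \<xi> > 0"
proof -
  have "P \<xi> \<in> T" "proj_perp P \<xi> \<in> N"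
    using P projector_onto_along_perp[OF P] by (auto simp: projector_onto_along_def)
  moreover have "P \<xi> \<noteq> 0 \<or> proj_perp P \<xi> \<noteq> 0"
    using \<open>\<xi> \<noteq> 0\<close> by (auto simp: proj_perp_def)
  ultimately show ?thesis
    using assms(2,3) linear_0[OF lin(1)] linear_0[OF lin(2)]
    unfolding landing_metric_def positive_definite_on_def
    by (cases "P \<xi> = 0"; cases "proj_perp P \<xi> = 0") (auto intro: add_pos_pos)
qed

lemma gradient_on_ex1:
  fixes g :: "'e::euclidean_space \<Rightarrow> 'e \<Rightarrow> real"
  assumes g: "bilinear g" and pos: "\<And>v. v \<in> V \<Longrightarrow> v \<noteq> 0 \<Longrightarrow> g v v > 0"
    and V: "subspace V" and h: "continuously_differentiable h"
  shows "\<exists>!v. v \<in> V \<and> (\<forall>\<xi>\<in>V. g v \<xi> = differential h x \<xi>)"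
proof -
  define L where "L = differential h x"
  have L: "linear L" unfolding L_def by (rule linear_differential[OF h])
  have gr: "linear (g v)" and gl: "linear (\<lambda>v. g v w)" for v w
    using g by (auto simp: bilinear_def)
  obtain B where B: "B \<subseteq> V" "independent B" "V \<subseteq> span B" by (metis basis_exists)
  have VB: "V = span B" using B V by (metis span_minimal subset_antisym)
  have fB: "finite B" using B(2) by (rule independent_imp_finite)
  define A where "A v = (\<Sum>b\<in>B. g v b *\<^sub>R b)" for v
  have lin: "linear A" unfolding A_def
    by (intro linear_compose_sum ballI linear_compose_scale_right linearI)
       (simp_all add: linear_add[OF gl] linear_scale[OF gl] algebra_simps)
  have coeff: "\<forall>b\<in>B. u b = w b" if "(\<Sum>b\<in>B. u b *\<^sub>R b) = (\<Sum>b\<in>B. w b *\<^sub>R b)" for u w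
  proof -
    have "(\<Sum>b\<in>B. (u b - w b) *\<^sub>R b) = 0"
      using that by (simp add: scaleR_left_diff_distrib sum_subtractf)
    then show ?thesis using independentD[OF B(2) fB subset_refl] by fastforce
  qed
  have ext: "\<forall>\<xi>\<in>V. g v \<xi> = M \<xi>" if "\<forall>b\<in>B. g v b = M b" "linear M" for v M
    using linear_eq_on_span[OF gr that(2)] that(1) VB by auto
  have zero: "v = 0" if "v \<in> V" "\<forall>\<xi>\<in>V. g v \<xi> = 0" for v
    using pos[of v] that by force
  have inj: "inj_on A V"
  proof (rule linear_injective_on_subspace_0[OF lin V, THEN iffD2], intro ballI impI)
    fix v assume v: "v \<in> V" "A v = 0"
    then have "\<forall>b\<in>B. g v b = 0" using coeff[of "g v" "\<lambda>_. 0"] by (simp add: A_def)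
    then show "v = 0" using ext[of v "\<lambda>_. 0"] linear_zero zero v(1) by blast
  qed
  have sub: "A ` V \<subseteq> V"
    using B(1) V by (auto simp: A_def intro!: subspace_sum subspace_scale)
  have "A ` V = V"
    using inj dim_image_eq[OF lin, of V] span_eq_iff[THEN iffD2, OF V]
    by (intro subspace_dim_equal[OF linear_subspace_image[OF lin V] V sub]) simp
  moreover have "(\<Sum>b\<in>B. L b *\<^sub>R b) \<in> V"
    using B(1) V by (auto intro!: subspace_sum subspace_scale)
  ultimately obtain v where v: "v \<in> V" "A v = (\<Sum>b\<in>B. L b *\<^sub>R b)" by (metis imageE)
  have "\<forall>\<xi>\<in>V. g v \<xi> = L \<xi>" using ext[OF coeff[OF v(2)[unfolded A_def]] L] .
  moreover have "w = v" if "w \<in> V" "\<forall>\<xi>\<in>V. g w \<xi> = L \<xi>" for w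
  proof -
    have "\<forall>\<xi>\<in>V. g (w - v) \<xi> = 0"
      using calculation that(2) by (simp add: linear_diff[OF gl])
    then show ?thesis using zero[of "w - v"] V v(1) that(1) by (simp add: subspace_diff)
  qed
  ultimately show ?thesis using v(1) unfolding L_def by blast
qed

lemma continuously_differentiable_infeasibility:
  assumes "continuously_differentiable c"
  shows "continuously_differentiable (infeasibility c)"
proof -
  obtain c' where c': "\<And>x. (c has_derivative blinfun_apply (c' x)) (at x)"
    "continuous_on UNIV c'"
    using assms unfolding continuously_differentiable_def by blast
  have c: "continuous_on UNIV c"
    by (meson c'(1) continuous_at_imp_continuous_on has_derivative_continuous)
  have "(infeasibility c has_derivative
      blinfun_apply (blinfun_inner_left (c x) o\<^sub>L c' x)) (at x)" for x
    unfolding infeasibility_def[abs_def] power2_norm_eq_inner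
    by (auto intro!: derivative_eq_intros c'(1) simp: inner_commute)
  moreover have "continuous_on UNIV (\<lambda>x. blinfun_inner_left (c x) o\<^sub>L c' x)"
    by (intro continuous_intros c c'(2))
  ultimately show ?thesis unfolding continuously_differentiable_def
    by (intro exI[of _ "\<lambda>x. blinfun_inner_left (c x) o\<^sub>L c' x"]) simp
qed

lemma GDERIV_euclidean_gradient:
  fixes f :: "'e::euclidean_space \<Rightarrow> real"
  assumes "continuously_differentiable f"
  shows "GDERIV f x :> euclidean_gradient f x"
proof -
  obtain D where D: "(f has_derivative D) (at x)"
    using assms unfolding continuously_differentiable_def by blast
  then have "D = (\<lambda>h. h \<bullet> adjoint D 1)"
    using adjoint_works[OF has_derivative_linear[OF D], of _ 1] by simp
  with D have ex: "GDERIV f x :> adjoint D 1" by (simp add: gderiv_def)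
  have "v = w" if "GDERIV f x :> v" "GDERIV f x :> w" for v w
    using has_derivative_unique[OF that[unfolded gderiv_def]]
    by (metis vector_eq_rdot inner_commute)
  with ex show ?thesis unfolding euclidean_gradient_def by (metis (mono_tags, lifting) theI)
qed

end

theory Submission
  imports Defs
begin

text \<open>By symmetry of \<open>G\<^sub>T\<close> and \<open>G\<^sub>N\<close>, the metric is the Euclidean pairing of \<open>\<xi>\<close> with the sum of the
  two compressed operators applied to \<open>v\<close>, of which the normal one vanishes for tangent \<open>v\<close> and the
  tangent one for normal \<open>v\<close>. Hence solving the respective compressed equation gives a vector with
  the defining property of the gradient, and gradients are unique. In particular the gradient of the
  infeasibility over the whole space lies in \<open>N\<close>.\<close>

lemma differential_eqI: "(h has_derivative D) (at x) \<Longrightarrow> differential h x = D"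
  unfolding differential_def by (rule frechet_derivative_at[symmetric])

lemma has_derivative_differential:
  assumes "continuously_differentiable h"
  shows "(h has_derivative differential h x) (at x)"
  using assms differential_eqI unfolding continuously_differentiable_def by metis

lemma differential_eq_inner_gradient:
  fixes f :: "'e::euclidean_space \<Rightarrow> real"
  assumes "continuously_differentiable f"
  shows "differential f x \<xi> = euclidean_gradient f x \<bullet> \<xi>"
  using differential_eqI[OF GDERIV_euclidean_gradient[OF assms, unfolded gderiv_def]]
  by (simp add: inner_commute)

text \<open>The product rule for \<open>c x \<bullet> c x\<close> yields two equal terms by symmetry
  of the inner product, and the factor 1/2 leaves one.\<close>

lemma differential_infeasibility:
  fixes c :: "'e::euclidean_space \<Rightarrow> 'f::euclidean_space"
  assumes "continuously_differentiable c"
  shows "differential (infeasibility c) x \<xi> = c x \<bullet> differential c x \<xi>"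
proof -
  have "(infeasibility c has_derivative (\<lambda>\<xi>. c x \<bullet> differential c x \<xi>)) (at x)"
    unfolding infeasibility_def[abs_def] power2_norm_eq_inner
    by (auto intro!: derivative_eq_intros has_derivative_differential[OF assms]
        simp: inner_commute)
  from differential_eqI[OF this] show ?thesis by simp
qed

text \<open>\<open>adjoint Q\<close> moves across as \<open>Q \<xi>\<close>, then symmetry moves
  \<open>G\<close>; this yields the form of each summand of \<open>landing_metric\<close>.\<close>

lemma inner_compressed_op:
  "linear Q \<Longrightarrow> symmetric_operator G \<Longrightarrow> compressed_op Q G v \<bullet> \<xi> = Q v \<bullet> G (Q \<xi>)"
  by (simp add: compressed_op_def symmetric_operator_def adjoint_clauses)

lemma landing_metric_eq_compressed:
  assumes "linear P" "symmetric_operator G\<^sub>T" "symmetric_operator G\<^sub>N"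
  shows "landing_metric P G\<^sub>T G\<^sub>N v \<xi> =
    compressed_op P G\<^sub>T v \<bullet> \<xi> + compressed_op (proj_perp P) G\<^sub>N v \<bullet> \<xi>"
  using assms by (simp add: landing_metric_def inner_compressed_op linear_proj_perp)

lemma compressed_op_kernel:
  assumes "linear Q" "symmetric_operator G" "Q v = 0"
  shows "compressed_op Q G v = 0"
  using assms by (simp add: compressed_op_def symmetric_operator_def linear_0 adjoint_linear)

text \<open>Positivity makes \<open>g\<close> nondegenerate on \<open>V\<close>, so the
  \<open>THE\<close> in \<open>gradient_on\<close> can only denote \<open>v\<close>. Applied with
  \<open>V\<close> the tangent space and with \<open>V = UNIV\<close>.\<close>

lemma gradient_on_eqI:
  fixes g :: "'e::euclidean_space \<Rightarrow> 'e \<Rightarrow> real"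
  assumes "bilinear g" "\<And>v. v \<noteq> 0 \<Longrightarrow> g v v > 0" "subspace V" "continuously_differentiable h"
    and "v \<in> V" "\<And>\<xi>. \<xi> \<in> V \<Longrightarrow> g v \<xi> = differential h x \<xi>"
  shows "gradient_on g V h x = v"
  unfolding gradient_on_def
  by (rule the1_equality[OF gradient_on_ex1]) (use assms in auto)

theorem proposition4p2:
  fixes f :: "'e::euclidean_space \<Rightarrow> real"
    and c :: "'e \<Rightarrow> 'f::euclidean_space"
    and P G\<^sub>T G\<^sub>N :: "'e \<Rightarrow> 'e"
    and N :: "'e set"
    and x :: 'e
  assumes "DIM('f) < DIM('e)"
    and "continuously_differentiable f"
    and "continuously_differentiable c"
    and "x \<in> full_rank_set c"
    and "projector_onto_along P (tangent_space c x) N"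
    and "symmetric_operator G\<^sub>T"
    and "symmetric_operator G\<^sub>N"
    and "positive_definite_on (tangent_space c x) G\<^sub>T"
    and "positive_definite_on N G\<^sub>N"
  shows "tangent_direction (landing_metric P G\<^sub>T G\<^sub>N) c f x =
           - inv_into (tangent_space c x) (compressed_op P G\<^sub>T)
               (adjoint P (euclidean_gradient f x))
       \<and> normal_direction (landing_metric P G\<^sub>T G\<^sub>N) c x =
           - inv_into N (compressed_op (proj_perp P) G\<^sub>N)
               (adjoint (differential c x) (c x))"
proof -
  let ?T = "tangent_space c x"
  let ?g = "landing_metric P G\<^sub>T G\<^sub>N"
  have P: "linear P" "\<And>v. v \<in> ?T \<Longrightarrow> P v = v" "\<And>v. v \<in> N \<Longrightarrow> P v = 0"
    using assms(5)[unfolded projector_onto_along_def op_kernel_def]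
    by - (blast, metis rangeE, blast)
  have Q: "\<And>v. v \<in> ?T \<Longrightarrow> proj_perp P v = 0"
    using P(2) by (simp add: proj_perp_def)
  have G: "linear G\<^sub>T" "linear G\<^sub>N"
    using assms(6,7) by (simp_all add: symmetric_operator_def)
  have Dc: "linear (differential c x)" by (rule linear_differential[OF assms(3)])
  have sT: "subspace ?T" unfolding tangent_space_def by (rule subspace_op_kernel[OF Dc])
  have bil: "bilinear ?g" by (rule bilinear_landing_metric[OF P(1) G])
  have pos: "?g v v > 0" if "v \<noteq> 0" for v
    by (rule landing_metric_pos[OF assms(5,8,9) G that])
  note metric = landing_metric_eq_compressed[OF P(1) assms(6,7)]

  define u where "u = inv_into ?T (compressed_op P G\<^sub>T) (adjoint P (euclidean_gradient f x))"
  \<comment> \<open>The right-hand side lies in the orthogonal complement of \<open>N\<close>, the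
    image of \<open>?T\<close> under the compressed operator, so \<open>inv_into\<close> returns a
    genuine preimage in \<open>?T\<close>.\<close>
  have u: "u \<in> ?T" "compressed_op P G\<^sub>T u = adjoint P (euclidean_gradient f x)"
    using bij_betw_compressed_tangent[OF assms(5,6,8)]
      adjoint_projector_in_orthogonal_comp[OF assms(5)]
    unfolding u_def bij_betw_def by (auto intro: inv_into_into f_inv_into_f)
  have "gradient_on ?g ?T f x = u"
  proof (rule gradient_on_eqI[OF bil pos sT assms(2) u(1)])
    fix \<xi> assume "\<xi> \<in> ?T"
    \<comment> \<open>Only the tangent summand survives, and \<open>P \<xi> = \<xi>\<close> removes
      the adjoint projector from the pairing with the gradient.\<close>
    then show "?g u \<xi> = differential f x \<xi>"
      using compressed_op_kernel[OF linear_proj_perp[OF P(1)] assms(7) Q[OF u(1)]]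
      by (simp add: metric u(2) adjoint_clauses[OF P(1)] P(2)
          differential_eq_inner_gradient[OF assms(2)])
  qed
  moreover
  define w where "w = inv_into N (compressed_op (proj_perp P) G\<^sub>N) (adjoint (differential c x) (c x))"
  \<comment> \<open>Here the target is the orthogonal complement of the kernel of the differential,
    which contains the range of its adjoint.\<close>
  have w: "w \<in> N" "compressed_op (proj_perp P) G\<^sub>N w = adjoint (differential c x) (c x)"
    using bij_betw_compressed_normal[OF assms(5,7,9)]
      adjoint_differential_in_orthogonal_comp[OF assms(3)]
    unfolding w_def bij_betw_def by (auto intro: inv_into_into f_inv_into_f)
  have "gradient_on ?g UNIV (infeasibility c) x = w"
  proof (rule gradient_on_eqI[OF bil pos subspace_UNIV
        continuously_differentiable_infeasibility[OF assms(3)] UNIV_I])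
    fix \<xi>
    \<comment> \<open>As \<open>P w = 0\<close>, only the normal summand remains; moving the adjoint
      gives \<open>c x \<bullet> differential c x \<xi>\<close> for every \<open>\<xi>\<close>,
      tangent or not.\<close>
    show "?g w \<xi> = differential (infeasibility c) x \<xi>"
      using compressed_op_kernel[OF P(1) assms(6) P(3)[OF w(1)]]
      by (simp add: metric w(2) adjoint_clauses[OF Dc] differential_infeasibility[OF assms(3)])
  qed
  ultimately show ?thesis
    by (simp add: tangent_direction_def normal_direction_def u_def w_def)
qed

end
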